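(* Let $a,b,c$ be positive integers with $a\le b\le c$, and let $K_{a,b,c}$ be the complete tripartite graph with partite sets of sizes $a$, $b$, $c$. The minimum defect in a $2$-coloring of $K_{a,b,c}$ is \[ D(K_{a,b,c},2)=\frac{bc}{b+c-a}. \]
   Context: Graphs are finite and simple. For a graph $G$ and a positive integer $k$, a (fractional) $k$-coloring of $G$ is an assignment to every vertex $v$ of real numbers $f_1(v),\dots,f_k(v)\ge 0$ with $\sum_{j=1}^k f_j(v)=1$ ($f_j(v)$ is the usage of color $j$ at $v$). The defect of $v$ is $\mathrm{df}(v)=\sum_{w\in N(v)}\sum_{j=1}^k\min(f_j(v),f_j(w))$, where $N(v)$ is the set of neighbors of $v$. The defect of the coloring is $\max_v \mathrm{df}(v)$, and the minimum defect $D(G,k)$ is the minimum of this quantity over all $k$-colorings of $G$. *)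

theory Defs
  imports "HOL-Analysis.Analysis" "Graph_Theory.Graph_Theory"
begin

definition neighbors :: "('a, 'b) pre_digraph \<Rightarrow> 'a \<Rightarrow> 'a set" where
  "neighbors G v = {w. v \<rightarrow>\<^bsub>G\<^esub> w}"

text \<open>
  \<open>f v j\<close> is the usage of colour \<open>j\<close> at \<open>v\<close>. The values outside \<open>verts G\<close> and \<open>{1..k}\<close> are
  unconstrained and never used.
\<close>

definition fractional_coloring ::
    "('a, 'b) pre_digraph \<Rightarrow> nat \<Rightarrow> ('a \<Rightarrow> nat \<Rightarrow> real) \<Rightarrow> bool" where
  "fractional_coloring G k f \<longleftrightarrow>
     (\<forall>v\<in>verts G. (\<forall>j\<in>{1..k}. 0 \<le> f v j) \<and> (\<Sum>j=1..k. f v j) = 1)"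

definition vertex_defect ::
    "('a, 'b) pre_digraph \<Rightarrow> nat \<Rightarrow> ('a \<Rightarrow> nat \<Rightarrow> real) \<Rightarrow> 'a \<Rightarrow> real" where
  "vertex_defect G k f v = (\<Sum>w\<in>neighbors G v. \<Sum>j=1..k. min (f v j) (f w j))"

definition defect :: "('a, 'b) pre_digraph \<Rightarrow> nat \<Rightarrow> ('a \<Rightarrow> nat \<Rightarrow> real) \<Rightarrow> real" where
  "defect G k f = Max (vertex_defect G k f ` verts G)"

text \<open>
  A genuine minimum rather than an infimum; see \<open>min_defect_attained\<close> below for its existence.
\<close>

definition min_defect :: "('a, 'b) pre_digraph \<Rightarrow> nat \<Rightarrow> real" where
  "min_defect G k = (LEAST d. \<exists>f. fractional_coloring G k f \<and> defect G k f = d)"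

text \<open>
  An undirected simple graph is a symmetric digraph satisfying the library locale \<open>graph\<close>, and
  \<open>K\<^bsub>a,b,c\<^esub>\<close> is characterised in the same style as the library's \<open>complete_bipartite_digraph\<close>.
\<close>

definition complete_tripartite_digraph ::
    "nat \<Rightarrow> nat \<Rightarrow> nat \<Rightarrow> ('a, 'b) pre_digraph \<Rightarrow> bool" where
  "complete_tripartite_digraph a b c G \<longleftrightarrow> graph G \<and>
     (\<exists>A B C. verts G = A \<union> B \<union> C \<and> A \<inter> B = {} \<and> A \<inter> C = {} \<and> B \<inter> C = {} \<and>
        card A = a \<and> card B = b \<and> card C = c \<and>
        arcs_ends G = A \<times> B \<union> B \<times> A \<union> A \<times> C \<union> C \<times> A \<union> B \<times> C \<union> C \<times> B)"

lemma complete_tripartite_digraph_exists: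
  "\<exists>G :: (nat, nat \<times> nat) pre_digraph. complete_tripartite_digraph a b c G"
proof -
  define A where "A = {..<a}"
  define B where "B = {a..<a+b}"
  define C where "C = {a+b..<a+b+c}"
  define G :: "nat pair_pre_digraph" where
    "G = \<lparr> pverts = A \<union> B \<union> C,
           parcs = A \<times> B \<union> B \<times> A \<union> A \<times> C \<union> C \<times> A \<union> B \<times> C \<union> C \<times> B \<rparr>"
  have disj: "A \<inter> B = {}" "A \<inter> C = {}" "B \<inter> C = {}"
    by (auto simp: A_def B_def C_def)
  have fin: "finite A" "finite B" "finite C"
    by (auto simp: A_def B_def C_def)
  have "finite (parcs G)" using fin by (simp add: G_def)
  then interpret pair_graph G
    using disj fin by unfold_locales (auto simp: G_def symmetric_def intro!: symI)
  have "graph (with_proj G)" by unfold_locales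
  moreover have "card A = a" "card B = b" "card C = c"
    by (auto simp: A_def B_def C_def)
  moreover have "verts (with_proj G) = A \<union> B \<union> C"
      "arcs_ends (with_proj G) = A \<times> B \<union> B \<times> A \<union> A \<times> C \<union> C \<times> A \<union> B \<times> C \<union> C \<times> B"
    by (simp_all add: G_def)
  ultimately have "complete_tripartite_digraph a b c (with_proj G)"
    unfolding complete_tripartite_digraph_def using disj by blast
  then show ?thesis by blast
qed

lemma min_defect_attained:
  fixes G :: "('a, 'b) pre_digraph"
  assumes "graph G" and "verts G \<noteq> {}" and "1 \<le> k"
  shows "\<exists>f. fractional_coloring G k f \<and> defect G k f = min_defect G k"
    and "fractional_coloring G k g \<Longrightarrow> min_defect G k \<le> defect G k g"
proof -
  interpret graph G by fact
  let ?V = "verts G"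
  have nbs: "neighbors G v \<subseteq> ?V" for v
    using adj_in_verts by (auto simp: neighbors_def)
  define dec :: "('a \<times> nat \<Rightarrow> real) \<Rightarrow> 'a \<Rightarrow> nat \<Rightarrow> real" where "dec p = (\<lambda>v j. p (v, j))" for p
  define I where "I = ?V \<times> {1..k}"
  define S where "S = (\<Pi>\<^sub>E i\<in>UNIV. if i \<in> I then {0..1} else {0::real})
      \<inter> (\<Inter>v\<in>?V. {p. (\<Sum>j=1..k. p (v, j)) = 1})"
  have "compactin (product_topology (\<lambda>i. euclidean) UNIV)
          (\<Pi>\<^sub>E i\<in>UNIV. if i \<in> I then {0..1} else {0::real})"
    by (subst compactin_PiE) (auto simp: compactin_euclidean_iff)
  then have c1: "compact (\<Pi>\<^sub>E i\<in>UNIV. if i \<in> I then {0..1} else {0::real})"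
    by (metis compactin_euclidean_iff euclidean_product_topology)
  have cl: "closed {p :: 'a \<times> nat \<Rightarrow> real. (\<Sum>j=1..k. p (v, j)) = 1}" for v
    by (intro closed_Collect_eq continuous_intros continuous_on_product_coordinates)
  have comp: "compact S"
    unfolding S_def using c1 cl by (intro compact_Int_closed closed_INT) auto
  have norm: "\<exists>p\<in>S. defect G k (dec p) = defect G k f" if f: "fractional_coloring G k f" for f
  proof -
    define p where "p = (\<lambda>i. if i \<in> I then f (fst i) (snd i) else 0)"
    have le1: "f v j \<le> 1" if "v \<in> ?V" "j \<in> {1..k}" for v j
    proof -
      have "f v j \<le> (\<Sum>j=1..k. f v j)"
        using f that by (intro member_le_sum) (auto simp: fractional_coloring_def)
      then show ?thesis using f that by (simp add: fractional_coloring_def)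
    qed
    have "p \<in> S"
      using f le1 by (auto simp: S_def p_def I_def fractional_coloring_def PiE_iff)
    moreover have "vertex_defect G k (dec p) v = vertex_defect G k f v" if "v \<in> ?V" for v
      unfolding vertex_defect_def using that nbs
      by (intro sum.cong refl) (auto simp: dec_def p_def I_def subset_iff)
    then have "defect G k (dec p) = defect G k f" by (simp add: defect_def)
    ultimately show ?thesis by blast
  qed
  have col: "fractional_coloring G k (dec p)" if "p \<in> S" for p
  proof -
    have "0 \<le> p (v, j)" if "v \<in> ?V" "j \<in> {1..k}" for v j
      using \<open>p \<in> S\<close> that by (auto simp: S_def I_def PiE_iff split: if_splits dest!: spec[of _ "(v, j)"])
    then show ?thesis using that by (auto simp: fractional_coloring_def dec_def S_def)
  qed
  have "fractional_coloring G k (\<lambda>v j. if j = 1 then 1 else 0)"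
    using \<open>1 \<le> k\<close> by (auto simp: fractional_coloring_def)
  then have "S \<noteq> {}" using norm by blast
  have "continuous_on S (\<lambda>p. vertex_defect G k (dec p) v)" for v
    unfolding vertex_defect_def dec_def
    by (intro continuous_intros continuous_on_subset[OF continuous_on_product_coordinates]) auto
  moreover have "continuous_on S (\<lambda>p. Max ((\<lambda>v. h v p) ` W))"
    if "finite W" "W \<noteq> {}" "\<And>v. continuous_on S (h v)"
    for W :: "'a set" and h :: "'a \<Rightarrow> ('a \<times> nat \<Rightarrow> real) \<Rightarrow> real"
    using that by (induction W rule: finite_ne_induct) (auto intro!: continuous_intros)
  ultimately have "continuous_on S (\<lambda>p. defect G k (dec p))"
    unfolding defect_def using assms(2) by simp
  then obtain p where p: "p \<in> S" "\<And>q. q \<in> S \<Longrightarrow> defect G k (dec p) \<le> defect G k (dec q)"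
    using continuous_attains_inf[OF comp \<open>S \<noteq> {}\<close>] by blast
  have le: "defect G k (dec p) \<le> defect G k f" if "fractional_coloring G k f" for f
    using norm[OF that] p(2) by fastforce
  have eq: "min_defect G k = defect G k (dec p)"
    unfolding min_defect_def using col[OF p(1)] le by (intro Least_equality) auto
  show "\<exists>f. fractional_coloring G k f \<and> defect G k f = min_defect G k"
    using eq col[OF p(1)] by auto
  show "min_defect G k \<le> defect G k g" if "fractional_coloring G k g"
    using eq le[OF that] by simp
qed

end

theory Submission
  imports Defs
begin

text \<open>
  A \<open>2\<close>-colouring places every vertex \<open>v\<close> at a point \<open>x v = f v 1\<close> of \<open>[0, 1]\<close>, and the two minima
  of an edge \<open>vw\<close> add up to \<open>1 - \<bar>x v - x w\<bar>\<close>. So the defect of \<open>v\<close> is the total closeness of its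
  neighbours to \<open>v\<close>. Write \<open>D = bc / (b + c - a)\<close>.

  The value \<open>D\<close> is reached by putting \<open>A\<close> at \<open>0\<close>, \<open>C\<close> at \<open>1\<close> and \<open>B\<close> at the point
  \<open>(b - a) / (b + c - a)\<close>, which makes the defects of \<open>A\<close> and \<open>B\<close> equal.

  For the lower bound, suppose that all defects are below \<open>D\<close>. If \<open>c \<ge> a + b\<close>, averaging suffices:
  three points of \<open>[0, 1]\<close> have pairwise distances of sum at most \<open>2\<close> (\<open>triple_average\<close>), and this
  makes the average over \<open>A\<close> with weight \<open>c - a\<close> plus the average over \<open>B\<close> with weight \<open>b\<close> at
  least \<open>bc\<close>. If \<open>c \<le> a + b\<close>, this is too weak: when every part is split between \<open>0\<close> and \<open>1\<close>, the
  average defects of all three parts may be below \<open>D\<close>. Extreme vertices of the parts are used instead. The closeness \<open>1 - \<bar>p - q\<bar>\<close> is the measure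
  of the thresholds \<open>\<theta>\<close> that do not separate \<open>p\<close> from \<open>q\<close>. Hence, if a weighted sum of two defects
  is below \<open>K\<close>, then some single threshold gives less than \<open>K\<close> to the weighted numbers of neighbours
  on the own sides of the two vertices (\<open>obtain_cut\<close>), and the question becomes one of counting.

  Applied to the two extreme vertices of one part \<open>X\<close> whose \<open>N\<close> neighbours satisfy \<open>N \<ge> 2D\<close>, this
  shows that more than \<open>N - D\<close> of the neighbours lie strictly to one side of all of \<open>X\<close>
  (\<open>part_off_centre\<close>). If these are on the left, then \<open>X\<close> itself lies to the right; every part is thus
  either right or left. The parts \<open>B\<close> and \<open>C\<close> cannot lie on the same side (\<open>not_both_right\<close>), so by
  reflection and by exchanging \<open>B\<close> with \<open>C\<close> it may be assumed that \<open>A\<close> and \<open>B\<close> are right and \<open>C\<close> is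
  left. The arrangement then resembles one in which \<open>C\<close> comes first, \<open>B\<close> next and \<open>A\<close> last; weights \<open>b\<close>
  on the first vertex of \<open>B\<close> and \<open>c - a\<close> on the last vertex of \<open>A\<close>, of sum \<open>bc / D\<close>, give at least
  \<open>bc\<close> for every threshold (\<open>not_A_B_right_C_left\<close>), which is the contradiction.
\<close>

section \<open>Closeness of points and threshold cuts\<close>

definition closeness :: "('a \<Rightarrow> real) \<Rightarrow> 'a set \<Rightarrow> 'a \<Rightarrow> real" where
  "closeness x W v = (\<Sum>w\<in>W. 1 - \<bar>x v - x w\<bar>)"

definition left_count :: "('a \<Rightarrow> real) \<Rightarrow> real \<Rightarrow> 'a set \<Rightarrow> real" where
  "left_count x \<theta> W = real (card {w \<in> W. x w \<le> \<theta>})"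

definition same_side :: "('a \<Rightarrow> real) \<Rightarrow> real \<Rightarrow> 'a set \<Rightarrow> 'a \<Rightarrow> real" where
  "same_side x \<theta> W v = (\<Sum>w\<in>W. if (x w \<le> \<theta>) = (x v \<le> \<theta>) then 1 else 0)"

definition below :: "('a \<Rightarrow> real) \<Rightarrow> 'a set \<Rightarrow> 'a set \<Rightarrow> real" where
  "below x X W = real (card {w \<in> W. \<forall>v\<in>X. x w < x v})"

lemma closeness_reflect: "closeness (\<lambda>v. 1 - x v) W v = closeness x W v"
  unfolding closeness_def by (intro sum.cong refl) auto

lemma left_count_le: "finite W \<Longrightarrow> left_count x \<theta> W \<le> card W"
  unfolding left_count_def by (simp add: card_mono)

lemma left_count_nonneg: "0 \<le> left_count x \<theta> W"
  unfolding left_count_def by simp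

lemma left_count_all: "\<forall>w\<in>W. x w \<le> \<theta> \<Longrightarrow> left_count x \<theta> W = card W"
  unfolding left_count_def by (intro arg_cong[where f = "\<lambda>S. real (card S)"]) auto

lemma left_count_none: "\<forall>w\<in>W. \<theta> < x w \<Longrightarrow> left_count x \<theta> W = 0"
  unfolding left_count_def by (auto simp: card_eq_0_iff)

lemma left_count_Un:
  "\<lbrakk>finite V; finite W; V \<inter> W = {}\<rbrakk>
    \<Longrightarrow> left_count x \<theta> (V \<union> W) = left_count x \<theta> V + left_count x \<theta> W"
  unfolding left_count_def
  by (subst of_nat_add[symmetric], subst card_Un_disjoint[symmetric])
     (auto intro!: arg_cong[where f = card])

lemma right_count:
  assumes "finite W"
  shows "real (card {w \<in> W. \<theta> < x w}) = card W - left_count x \<theta> W"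
proof -
  have "card W = card {w \<in> W. x w \<le> \<theta>} + card {w \<in> W. \<theta> < x w}"
    using assms by (subst card_Un_disjoint[symmetric]) (auto intro!: arg_cong[where f = card])
  then show ?thesis by (simp add: left_count_def)
qed

lemma same_side_left:
  assumes "finite W" "x v \<le> \<theta>"
  shows "same_side x \<theta> W v = left_count x \<theta> W"
  using assms by (simp add: same_side_def left_count_def sum.If_cases Int_def)

lemma same_side_right:
  assumes "finite W" "\<theta> < x v"
  shows "same_side x \<theta> W v = card W - left_count x \<theta> W"
  unfolding right_count[OF assms(1), symmetric]
  using assms by (simp add: same_side_def sum.If_cases Int_def not_le)

lemma below_Un:
  "\<lbrakk>finite V; finite W; V \<inter> W = {}\<rbrakk> \<Longrightarrow> below x X (V \<union> W) = below x X V + below x X W"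
  unfolding below_def
  by (subst of_nat_add[symmetric], subst card_Un_disjoint[symmetric])
     (auto intro!: arg_cong[where f = card])

lemma below_le_card: "finite W \<Longrightarrow> below x X W \<le> card W"
  unfolding below_def by (simp add: card_mono)

lemma below_none: "\<lbrakk>v \<in> X; \<forall>w\<in>W. x v \<le> x w\<rbrakk> \<Longrightarrow> below x X W = 0"
  unfolding below_def by (force simp: card_eq_0_iff)

lemma below_le_left_count:
  assumes "finite W" "v \<in> X" "x v \<le> \<theta>"
  shows "below x X W \<le> left_count x \<theta> W"
  unfolding below_def left_count_def using assms by (auto intro!: card_mono)

lemma above_le_right_count:
  assumes "finite W" "v \<in> X" "\<theta> < x v"
  shows "below (\<lambda>v. 1 - x v) X W \<le> card W - left_count x \<theta> W"
  unfolding below_def right_count[OF assms(1), symmetric]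
  using assms by (auto intro!: card_mono)

text \<open>
  The thresholds that separate \<open>p \<le> q\<close> form the interval \<open>[p, q)\<close>, of length \<open>q - p\<close>.
\<close>

lemma has_integral_unseparated:
  fixes p q :: real
  assumes "p \<in> {0..1}" "q \<in> {0..1}"
  shows "((\<lambda>\<theta>. if (q \<le> \<theta>) = (p \<le> \<theta>) then 1 else 0) has_integral (1 - \<bar>p - q\<bar>)) {0..1::real}"
proof -
  have *: "((\<lambda>\<theta>. if (q \<le> \<theta>) = (p \<le> \<theta>) then 1 else 0) has_integral (1 - (q - p))) {0..1::real}"
    if "0 \<le> p" "p \<le> q" "q \<le> 1" for p q :: real
  proof -
    have ind: "((\<lambda>\<theta>. if \<theta> \<in> {p..q} then 1 else 0) has_integral (q - p)) {0..1::real}"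
    proof -
      have "((\<lambda>_. 1::real) has_integral (q - p)) {p..q}"
        using has_integral_const_real[of "1::real" p q] that by simp
      then show ?thesis
        using that by (subst has_integral_restrict) auto
    qed
    have "((\<lambda>\<theta>. 1 - (if \<theta> \<in> {p..q} then 1 else 0)) has_integral (1 - (q - p))) {0..1::real}"
      using has_integral_diff[OF has_integral_const_real[of "1::real" 0 1] ind] by simp
    \<comment> \<open>The closed interval differs from the separating thresholds only in the point \<open>q\<close>.\<close>
    then show ?thesis
      by (rule has_integral_spike[of "{q}", rotated 2]) (use that in auto)
  qed
  show ?thesis
  proof (cases "p \<le> q")
    case True
    then show ?thesis using *[of p q] assms by simp
  next
    case False
    have "(\<lambda>\<theta>. if (q \<le> \<theta>) = (p \<le> \<theta>) then 1 else 0 :: real)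
        = (\<lambda>\<theta>. if (p \<le> \<theta>) = (q \<le> \<theta>) then 1 else 0)" by auto
    then show ?thesis using *[of q p] assms False by simp
  qed
qed

lemma has_integral_same_side:
  assumes "finite W" "\<And>w. w \<in> insert v W \<Longrightarrow> x w \<in> {0..1}"
  shows "((\<lambda>\<theta>. same_side x \<theta> W v) has_integral closeness x W v) {0..1}"
  unfolding same_side_def closeness_def
  using assms by (intro has_integral_sum has_integral_unseparated) auto

text \<open>
  Closeness is an integral of same-side counts over thresholds, so a weighted sum that is small on
  average is small at some threshold. Two vertices are enough for every use below.
\<close>

lemma obtain_cut:
  assumes "finite W" "finite W'" "\<And>w. w \<in> insert u W \<union> insert v W' \<Longrightarrow> x w \<in> {0..1}"
    and "p * closeness x W u + q * closeness x W' v < K"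
  obtains \<theta> where "p * same_side x \<theta> W u + q * same_side x \<theta> W' v < K"
proof (rule ccontr)
  assume "\<not> thesis"
  then have ge: "K \<le> p * same_side x \<theta> W u + q * same_side x \<theta> W' v" for \<theta>
    using that not_less by blast
  have "((\<lambda>\<theta>. p * same_side x \<theta> W u + q * same_side x \<theta> W' v) has_integral
      (p * closeness x W u + q * closeness x W' v)) {0..1}"
    using assms by (intro has_integral_add has_integral_mult_right has_integral_same_side) auto
  from has_integral_le[OF has_integral_const_real[of K 0 1] this] ge
  have "K \<le> p * closeness x W u + q * closeness x W' v" by simp
  with assms(4) show False by simp
qed

section \<open>Parts lie to one side of their neighbours\<close>

lemma obtain_first:
  fixes x :: "'a \<Rightarrow> real"
  assumes "finite X" "X \<noteq> {}"
  obtains v where "v \<in> X" "\<forall>w\<in>X. x v \<le> x w"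
  using arg_min_if_finite[OF assms, of x] by (metis not_le)

lemma obtain_last:
  fixes x :: "'a \<Rightarrow> real"
  assumes "finite X" "X \<noteq> {}"
  obtains v where "v \<in> X" "\<forall>w\<in>X. x w \<le> x v"
  using obtain_first[OF assms, of "\<lambda>v. - x v"] by auto

text \<open>
  A threshold between the first and the last vertex of \<open>X\<close> puts every neighbour on the side of exactly
  one of them, for a total of \<open>card W \<ge> 2 * D\<close>. The threshold at which the two together see less
  than \<open>2 * D\<close> therefore lies outside \<open>X\<close>, and there each of them sees less than \<open>D\<close>. The left case
  is expressed by reflecting the line, so that it becomes the right case of the reflected points.
\<close>

lemma part_off_centre:
  fixes D :: real
  assumes fin: "finite X" "finite W" and "X \<noteq> {}"
    and range: "\<And>w. w \<in> X \<union> W \<Longrightarrow> x w \<in> {0..1}"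
    and small: "\<And>v. v \<in> X \<Longrightarrow> closeness x W v < D"
    and half: "2 * D \<le> card W"
  shows "card W - D < below x X W \<or> card W - D < below (\<lambda>v. 1 - x v) X W"
proof -
  obtain u where u: "u \<in> X" "\<forall>w\<in>X. x u \<le> x w" using obtain_first[OF fin(1) \<open>X \<noteq> {}\<close>] .
  obtain v where v: "v \<in> X" "\<forall>w\<in>X. x w \<le> x v" using obtain_last[OF fin(1) \<open>X \<noteq> {}\<close>] .
  have "1 * closeness x W u + 1 * closeness x W v < 2 * D"
    using small[OF u(1)] small[OF v(1)] by simp
  then obtain \<theta> where \<theta>: "1 * same_side x \<theta> W u + 1 * same_side x \<theta> W v < 2 * D"
    using obtain_cut[OF fin(2) fin(2)] range u(1) v(1)
    by (metis Un_iff insert_iff)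
  consider "x v \<le> \<theta>" | "\<theta> < x u" | "x u \<le> \<theta>" "\<theta> < x v" by linarith
  then show ?thesis
  proof cases
    case 1
    then have "x u \<le> \<theta>" using u v by force
    with 1 \<theta> have "left_count x \<theta> W < D" using fin by (simp add: same_side_left)
    moreover have "card W - left_count x \<theta> W \<le> below (\<lambda>v. 1 - x v) X W"
      unfolding below_def right_count[OF fin(2), symmetric]
      using fin v 1 by (force intro!: card_mono)
    ultimately show ?thesis by linarith
  next
    case 2
    then have "\<theta> < x v" using u v by force
    with 2 \<theta> have "card W - left_count x \<theta> W < D" using fin by (simp add: same_side_right)
    moreover have "left_count x \<theta> W \<le> below x X W"
      unfolding below_def left_count_def
      using fin u 2 by (force intro!: card_mono)
    ultimately show ?thesis by linarith
  next
    case 3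
    with \<theta> half show ?thesis using fin by (simp add: same_side_left same_side_right)
  qed
qed

section \<open>Balanced part sizes\<close>

text \<open>
  The assumptions of an indirect proof, which turn out to be inconsistent. Only \<open>A\<close> is distinguished
  by its size: the order of \<open>card B\<close> and \<open>card C\<close> is left open and both triangle inequalities are
  required, so that \<open>B\<close> and \<open>C\<close> can be exchanged.
\<close>

locale low_defect_points =
  fixes A B C :: "'a set" and x :: "'a \<Rightarrow> real" and D :: real
  assumes finite: "finite A" "finite B" "finite C"
    and nonempty: "A \<noteq> {}" "B \<noteq> {}" "C \<noteq> {}"
    and disjoint: "A \<inter> B = {}" "A \<inter> C = {}" "B \<inter> C = {}"
    and range: "\<And>v. v \<in> A \<union> B \<union> C \<Longrightarrow> x v \<in> {0..1}"
    and A_smallest: "card A \<le> card B" "card A \<le> card C"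
    and triangle: "card B \<le> card A + card C" "card C \<le> card A + card B"
    and D_eq: "D * (real (card B) + real (card C) - real (card A)) = real (card B) * real (card C)"
    and small_A: "\<And>v. v \<in> A \<Longrightarrow> closeness x (B \<union> C) v < D"
    and small_B: "\<And>v. v \<in> B \<Longrightarrow> closeness x (A \<union> C) v < D"
    and small_C: "\<And>v. v \<in> C \<Longrightarrow> closeness x (A \<union> B) v < D"
begin

lemma reflected: "low_defect_points A B C (\<lambda>v. 1 - x v) D"
  using finite nonempty disjoint range A_smallest triangle D_eq small_A small_B small_C
  by unfold_locales (auto simp: closeness_reflect)

lemma swapped: "low_defect_points A C B x D"
  using finite nonempty disjoint range A_smallest triangle D_eq small_A small_B small_C
  by unfold_locales (auto simp: algebra_simps Un_commute)

abbreviation "a \<equiv> real (card A)"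
abbreviation "b \<equiv> real (card B)"
abbreviation "c \<equiv> real (card C)"

lemma card_facts: "0 < a" "a \<le> b" "a \<le> c" "c \<le> a + b" "b \<le> a + c"
  using finite nonempty A_smallest triangle by (auto simp: card_gt_0_iff simp flip: of_nat_add)

lemma D_bounds: "D \<le> b" "D \<le> c" "2 * D \<le> a + b" "2 * D \<le> a + c"
proof -
  have k: "0 < b + c - a" using card_facts by linarith
  have D: "D = b * c / (b + c - a)" using D_eq k by (simp add: field_simps)
  have "0 \<le> b * (b - a)" "0 \<le> c * (c - a)" "0 \<le> (b - a) * (a + b - c)" "0 \<le> (c - a) * (a + c - b)"
    using card_facts by auto
  then show "D \<le> b" "D \<le> c" "2 * D \<le> a + b" "2 * D \<le> a + c"
    unfolding D using k by (auto simp: divide_le_eq algebra_simps)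
qed

lemma sides:
  "a + c - D < below x B (A \<union> C) \<or> a + c - D < below (\<lambda>v. 1 - x v) B (A \<union> C)"
  "b + c - D < below x A (B \<union> C) \<or> b + c - D < below (\<lambda>v. 1 - x v) A (B \<union> C)"
proof -
  have cards: "card (A \<union> C) = a + c" "card (B \<union> C) = b + c"
    using finite disjoint by (simp_all add: card_Un_disjoint)
  show "a + c - D < below x B (A \<union> C) \<or> a + c - D < below (\<lambda>v. 1 - x v) B (A \<union> C)"
    using part_off_centre[of B "A \<union> C" x D] finite nonempty range small_B D_bounds cards by auto
  show "b + c - D < below x A (B \<union> C) \<or> b + c - D < below (\<lambda>v. 1 - x v) A (B \<union> C)"
    using part_off_centre[of A "B \<union> C" x D] finite nonempty range small_A D_bounds cards by auto
qed

text \<open>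
  The part among \<open>B\<close> and \<open>C\<close> that starts first has nothing of the other one below it, so only \<open>A\<close> can
  provide vertices there. For \<open>B\<close>, more than \<open>a + c - D\<close> of them would be needed, which is at least
  \<open>a\<close> because \<open>D \<le> c\<close>; for \<open>C\<close> the bound \<open>D \<le> b\<close> does the same.
\<close>

lemma not_both_right:
  assumes B: "a + c - D < below x B (A \<union> C)" and C: "a + b - D < below x C (A \<union> B)"
  shows False
proof -
  obtain u where u: "u \<in> B" "\<forall>w\<in>B. x u \<le> x w" using obtain_first[OF finite(2) nonempty(2)] .
  obtain v where v: "v \<in> C" "\<forall>w\<in>C. x v \<le> x w" using obtain_first[OF finite(3) nonempty(3)] .
  show False
  proof (cases "x u \<le> x v")
    case True
    then have "below x B C = 0" using u v by (intro below_none[OF u(1)]) force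
    then have "below x B (A \<union> C) \<le> a"
      using below_le_card[OF finite(1), of x B] finite disjoint by (simp add: below_Un)
    with B D_bounds show False by linarith
  next
    case False
    then have "below x C B = 0" using u v by (intro below_none[OF v(1)]) force
    then have "below x C (A \<union> B) \<le> a"
      using below_le_card[OF finite(1), of x C] finite disjoint by (simp add: below_Un)
    with C D_bounds show False by linarith
  qed
qed

text \<open>
  The weights \<open>b\<close> for \<open>u\<close>, the first vertex of \<open>B\<close>, and \<open>c - a\<close> for \<open>l\<close>, the last vertex of \<open>A\<close>,
  give exactly \<open>bc\<close> at the threshold with \<open>C\<close> on its left and \<open>A \<union> B\<close> on its right, and also at the
  one with \<open>B \<union> C\<close> on its left and \<open>A\<close> on its right. The positions of the parts keep all other
  thresholds close enough to such a situation, so that none falls below \<open>bc\<close>.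
\<close>

lemma not_A_B_right_C_left:
  assumes A: "b + c - D < below x A (B \<union> C)" and B: "a + c - D < below x B (A \<union> C)"
    and C: "a + b - D < below (\<lambda>v. 1 - x v) C (A \<union> B)"
  shows False
proof -
  obtain u where u: "u \<in> B" "\<forall>w\<in>B. x u \<le> x w" using obtain_first[OF finite(2) nonempty(2)] .
  obtain v where v: "v \<in> A" "\<forall>w\<in>A. x v \<le> x w" using obtain_first[OF finite(1) nonempty(1)] .
  obtain l where l: "l \<in> A" "\<forall>w\<in>A. x w \<le> x l" using obtain_last[OF finite(1) nonempty(1)] .
  \<comment> \<open>If \<open>A\<close> started before \<open>B\<close>, only \<open>C\<close> could lie below \<open>A\<close>, and \<open>b + c - D \<ge> c\<close>.\<close>
  have uA: "\<forall>w\<in>A. x u \<le> x w"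
  proof (rule ccontr)
    assume "\<not> ?thesis"
    then have "below x A B = 0" using u v by (intro below_none[OF v(1)]) force
    then have "below x A (B \<union> C) \<le> c"
      using below_le_card[OF finite(3), of x A] finite disjoint by (simp add: below_Un)
    with A D_bounds show False by linarith
  qed
  then have "below x B A = 0" by (intro below_none[OF u(1)])
  with B have below_C: "a + c - D < below x B C" using finite disjoint by (simp add: below_Un)
  have "b * closeness x (A \<union> C) u + (c - a) * closeness x (B \<union> C) l < b * D + (c - a) * D"
    using small_B[OF u(1)] small_A[OF l(1)] card_facts
    by (intro add_less_le_mono mult_strict_left_mono mult_left_mono) auto
  also have "\<dots> = b * c" using D_eq by (simp add: algebra_simps)
  finally obtain \<theta> where
    \<theta>: "b * same_side x \<theta> (A \<union> C) u + (c - a) * same_side x \<theta> (B \<union> C) l < b * c"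
    by (rule obtain_cut[rotated 3]) (use finite range u l in auto)
  define \<alpha> \<beta> \<gamma> where "\<alpha> = left_count x \<theta> A" and "\<beta> = left_count x \<theta> B" and "\<gamma> = left_count x \<theta> C"
  note defs = \<alpha>_def \<beta>_def \<gamma>_def
  have bounds: "0 \<le> \<alpha>" "\<alpha> \<le> a" "0 \<le> \<beta>" "\<beta> \<le> b" "0 \<le> \<gamma>" "\<gamma> \<le> c"
    unfolding defs using finite by (auto intro: left_count_le left_count_nonneg)
  have Un: "left_count x \<theta> (A \<union> C) = \<alpha> + \<gamma>" "left_count x \<theta> (B \<union> C) = \<beta> + \<gamma>"
    "card (A \<union> C) = a + c" "card (B \<union> C) = b + c"
    unfolding defs using finite disjoint by (simp_all add: left_count_Un card_Un_disjoint)
  \<comment> \<open>The gaps \<open>D - a\<close> and \<open>b - D\<close> that bound the misplaced vertices, cleared of denominators.\<close>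
  have kD: "(b + c - a) * (D - a) = (b - a) * (c - a)" "(b + c - a) * (b - D) = b * (b - a)"
    using D_eq by (auto simp: algebra_simps)
  have \<gamma>: "c - \<gamma> < D - a" if "x u \<le> \<theta>"
    using below_C below_le_left_count[where x = x, OF finite(3) u(1) that] unfolding defs by linarith
  have k: "0 < b + c - a" using card_facts by linarith
  consider "\<theta> < x u" | "x u \<le> \<theta>" "\<theta> < x l" | "x u \<le> \<theta>" "x l \<le> \<theta>" by linarith
  then show False
  proof cases
    case 1
    then have "\<alpha> = 0" "\<beta> = 0" "\<theta> < x l"
      unfolding defs using u uA l by (auto intro!: left_count_none)
    with 1 \<theta> have "b * (a + c - \<gamma>) + (c - a) * (b + c - \<gamma>) < b * c"
      using finite by (simp add: same_side_right Un algebra_simps)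
    moreover have "0 \<le> b * (c - \<gamma>)" "0 \<le> (c - a) * (c - \<gamma>)"
      using bounds card_facts by auto
    ultimately show False by (simp add: algebra_simps)
  next
    case 2
    then have less: "b * (\<alpha> + \<gamma>) + (c - a) * (b - \<beta> + (c - \<gamma>)) < b * c"
      using \<theta> finite by (simp add: same_side_right same_side_left Un algebra_simps)
    show False
    proof (cases "\<forall>w\<in>C. x w \<le> \<theta>")
      case True
      then have "\<gamma> = c" unfolding defs by (rule left_count_all)
      moreover have "0 \<le> b * \<alpha>" "0 \<le> (c - a) * (b - \<beta>)" using bounds card_facts by auto
      ultimately show False using less by (simp add: algebra_simps)
    next
      case False
      then obtain z where z: "z \<in> C" "\<theta> < x z" by (auto simp: not_le)
      \<comment> \<open>The threshold lies before some vertex of \<open>C\<close>, so what is above \<open>C\<close> is above the threshold.\<close>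
      have "\<alpha> + \<beta> < D"
        using C above_le_right_count[where x = x, OF finite(1) z]
          above_le_right_count[where x = x, OF finite(2) z] finite disjoint
        unfolding defs by (simp add: below_Un)
      then have \<beta>: "b - D \<le> b - \<beta>" using bounds by linarith
      \<comment> \<open>At most \<open>D - a\<close> vertices of \<open>C\<close> are missing on the left, and this loss is covered by the
        at least \<open>b - D\<close> vertices of \<open>B\<close> that are still on the right.\<close>
      have "(c - \<gamma>) * (a + b - c) \<le> (D - a) * b"
        using \<gamma>[OF 2(1)] card_facts bounds by (intro mult_mono) auto
      also have "\<dots> = (c - a) * (b - D)"
      proof -
        have "(b + c - a) * ((D - a) * b) = (b + c - a) * ((c - a) * (b - D))"
          using kD by (metis mult.assoc mult.left_commute mult.commute)
        then show ?thesis using k by simp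
      qed
      also have "\<dots> \<le> (c - a) * (b - \<beta>)" using \<beta> card_facts by (intro mult_left_mono) auto
      finally have "(c - \<gamma>) * (a + b - c) \<le> (c - a) * (b - \<beta>)" .
      moreover have "0 \<le> b * \<alpha>" using bounds by simp
      ultimately show False using less by (simp add: algebra_simps)
    qed
  next
    case 3
    then have "\<alpha> = a" unfolding defs using l by (auto intro!: left_count_all)
    with 3 have "b * (a + \<gamma>) + (c - a) * (\<beta> + \<gamma>) < b * c"
      using \<theta> finite by (simp add: same_side_left Un)
    moreover have "(b + c - a) * (c - \<gamma>) \<le> (b + c - a) * (D - a)"
      using \<gamma>[OF 3(1)] k by (intro mult_left_mono) auto
    moreover have "0 \<le> (c - a) * \<beta>" using bounds card_facts by simp
    moreover have "(c - a) * (b - a) \<le> (c - a) * c + a * b"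
    proof -
      have "(c - a) * (b - a) \<le> (c - a) * c" using card_facts by (intro mult_left_mono) auto
      moreover have "0 \<le> a * b" by simp
      ultimately show ?thesis by linarith
    qed
    ultimately show False using kD(1) by (simp add: algebra_simps)
  qed
qed

lemma contradiction: False
proof -
  interpret r: low_defect_points A B C "\<lambda>v. 1 - x v" D by (rule reflected)
  interpret s: low_defect_points A C B x D by (rule swapped)
  interpret rs: low_defect_points A C B "\<lambda>v. 1 - x v" D by (rule r.swapped)
  show False
    using sides s.sides not_both_right r.not_both_right
      not_A_B_right_C_left r.not_A_B_right_C_left s.not_A_B_right_C_left rs.not_A_B_right_C_left
    by (auto simp: Un_commute add.commute)
qed

end

section \<open>One dominant part\<close>

lemma sum_closeness_commute:
  "(\<Sum>v\<in>V. closeness x W v) = (\<Sum>w\<in>W. closeness x V w)"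
  unfolding closeness_def by (subst sum.swap) (simp add: abs_minus_commute)

text \<open>
  Sum over all triples of the fact that the pairwise distances of three points of \<open>[0, 1]\<close> add up
  to at most \<open>2\<close>, that is, that the three closenesses add up to at least \<open>1\<close>.
\<close>

lemma triple_average:
  assumes "\<And>v. v \<in> A \<union> B \<union> C \<Longrightarrow> x v \<in> {0..1}"
  shows "real (card A) * card B * card C \<le> card C * (\<Sum>v\<in>A. closeness x B v)
    + card B * (\<Sum>v\<in>A. closeness x C v) + card A * (\<Sum>v\<in>B. closeness x C v)"
proof -
  have "real (card A) * card B * card C = (\<Sum>u\<in>A. \<Sum>v\<in>B. \<Sum>w\<in>C. 1)" by simp
  also have "\<dots> \<le> (\<Sum>u\<in>A. \<Sum>v\<in>B. \<Sum>w\<in>C.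
      (1 - \<bar>x u - x v\<bar>) + (1 - \<bar>x u - x w\<bar>) + (1 - \<bar>x v - x w\<bar>))"
  proof (intro sum_mono)
    fix u v w assume "u \<in> A" "v \<in> B" "w \<in> C"
    then have "x u \<in> {0..1}" "x v \<in> {0..1}" "x w \<in> {0..1}" using assms by auto
    then show "1 \<le> (1 - \<bar>x u - x v\<bar>) + (1 - \<bar>x u - x w\<bar>) + (1 - \<bar>x v - x w\<bar>)" by auto
  qed
  also have "\<dots> = (\<Sum>u\<in>A. \<Sum>v\<in>B. \<Sum>w\<in>C. 1 - \<bar>x u - x v\<bar>)
      + (\<Sum>u\<in>A. \<Sum>v\<in>B. \<Sum>w\<in>C. 1 - \<bar>x u - x w\<bar>)
      + (\<Sum>u\<in>A. \<Sum>v\<in>B. \<Sum>w\<in>C. 1 - \<bar>x v - x w\<bar>)"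
    by (simp only: sum.distrib)
  also have "(\<Sum>u\<in>A. \<Sum>v\<in>B. \<Sum>w\<in>C. 1 - \<bar>x u - x v\<bar>)
      = card C * (\<Sum>v\<in>A. closeness x B v)"
    by (simp only: closeness_def sum_constant sum_distrib_left)
  also have "(\<Sum>u\<in>A. \<Sum>v\<in>B. \<Sum>w\<in>C. 1 - \<bar>x u - x w\<bar>)
      = card B * (\<Sum>v\<in>A. closeness x C v)"
    by (simp only: closeness_def[symmetric] sum_constant sum_distrib_left)
  also have "(\<Sum>u\<in>A. \<Sum>v\<in>B. \<Sum>w\<in>C. 1 - \<bar>x v - x w\<bar>)
      = card A * (\<Sum>v\<in>B. closeness x C v)"
    by (simp only: closeness_def[symmetric] sum_constant)
  finally show ?thesis .
qed

text \<open>
  In the unbalanced case, the defects of \<open>A\<close> get total weight \<open>c - a\<close> and those of \<open>B\<close> total weight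
  \<open>b\<close>; the proof multiplies through by \<open>a\<close>. Since \<open>c - a \<ge> b\<close>, every pair of parts then counts at
  least as much as in \<open>triple_average\<close>.
\<close>

lemma no_low_defect_points:
  fixes x :: "'a \<Rightarrow> real"
  assumes finite: "finite A" "finite B" "finite C"
    and disjoint: "A \<inter> B = {}" "A \<inter> C = {}" "B \<inter> C = {}"
    and range: "\<And>v. v \<in> A \<union> B \<union> C \<Longrightarrow> x v \<in> {0..1}"
    and cards: "0 < card A" "card A \<le> card B" "card B \<le> card C"
    and D_eq: "D * (real (card B) + real (card C) - real (card A)) = real (card B) * real (card C)"
    and small_A: "\<And>v. v \<in> A \<Longrightarrow> closeness x (B \<union> C) v < D"
    and small_B: "\<And>v. v \<in> B \<Longrightarrow> closeness x (A \<union> C) v < D"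
    and small_C: "\<And>v. v \<in> C \<Longrightarrow> closeness x (A \<union> B) v < D"
  shows False
proof (cases "card C \<le> card A + card B")
  case True
  have "A \<noteq> {}" "B \<noteq> {}" "C \<noteq> {}" using cards by auto
  then interpret low_defect_points A B C x D
    using finite disjoint range cards True D_eq small_A small_B small_C by unfold_locales auto
  show False by (rule contradiction)
next
  case False
  define a b c where "a = real (card A)" and "b = real (card B)" and "c = real (card C)"
  define AB AC BC where "AB = (\<Sum>v\<in>A. closeness x B v)" and "AC = (\<Sum>v\<in>A. closeness x C v)"
    and "BC = (\<Sum>v\<in>B. closeness x C v)"
  have abc: "0 < a" "a \<le> b" "a + b \<le> c" using cards False unfolding a_def b_def c_def by linarith+
  have "A \<noteq> {}" "B \<noteq> {}" using cards by auto
  have "AB + AC = (\<Sum>v\<in>A. closeness x (B \<union> C) v)"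
    unfolding AB_def AC_def closeness_def
    using finite disjoint by (simp add: sum.union_disjoint sum.distrib)
  also have "\<dots> < a * D"
    using sum_strict_mono[OF finite(1) \<open>A \<noteq> {}\<close> small_A] by (simp add: a_def)
  finally have A: "AB + AC < a * D" .
  have "AB + BC = (\<Sum>v\<in>B. closeness x (A \<union> C) v)"
    unfolding AB_def BC_def sum_closeness_commute[of x B A] closeness_def
    using finite disjoint by (simp add: sum.union_disjoint sum.distrib)
  also have "\<dots> < b * D"
    using sum_strict_mono[OF finite(2) \<open>B \<noteq> {}\<close> small_B] by (simp add: b_def)
  finally have B: "AB + BC < b * D" .
  have "0 \<le> AC" unfolding AC_def closeness_def
  proof (intro sum_nonneg)
    fix u w assume "u \<in> A" "w \<in> C"
    then have "x u \<in> {0..1}" "x w \<in> {0..1}" using range by auto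
    then show "0 \<le> 1 - \<bar>x u - x w\<bar>" by auto
  qed
  then have "b * AC \<le> (c - a) * AC" using abc by (intro mult_right_mono) auto
  then have "a * b * c \<le> (c - a) * (AB + AC) + a * (AB + BC)"
    using triple_average[of A B C x, OF range] unfolding a_def b_def c_def AB_def AC_def BC_def
    by (simp add: algebra_simps)
  also have "\<dots> < (c - a) * (a * D) + a * (b * D)"
    using A B abc by (intro add_le_less_mono mult_left_mono mult_strict_left_mono) auto
  also have "\<dots> = a * (D * (b + c - a))" by (simp add: algebra_simps)
  also have "\<dots> = a * b * c" using D_eq by (simp add: a_def b_def c_def)
  finally show False by simp
qed

section \<open>Colourings with two colours\<close>

lemma vertex_defect_2:
  assumes "fractional_coloring G 2 f" "v \<in> verts G" "neighbors G v \<subseteq> verts G"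
  shows "vertex_defect G 2 f v = closeness (\<lambda>v. f v 1) (neighbors G v) v"
proof -
  have two: "{1..2} = {1, 2::nat}" by auto
  have sum1: "f w 2 = 1 - f w 1" if "w \<in> verts G" for w
    using assms(1) that unfolding fractional_coloring_def two by (auto simp: algebra_simps)
  show ?thesis
    unfolding vertex_defect_def closeness_def two
    using assms(2,3) sum1 by (intro sum.cong refl) (auto simp: min_def)
qed

lemma fractional_coloring_2_range:
  assumes "fractional_coloring G 2 f" "v \<in> verts G"
  shows "f v 1 \<in> {0..1}"
proof -
  have two: "{1..2} = {1, 2::nat}" by auto
  show ?thesis using assms unfolding fractional_coloring_def two by auto
qed

theorem proposition7:
  fixes G :: "('a, 'b) pre_digraph" and a b c :: nat
  assumes "0 < a" and "a \<le> b" and "b \<le> c"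
    and "complete_tripartite_digraph a b c G"
  shows "min_defect G 2 = (real b * real c) / (real b + real c - real a)"
proof -
  obtain A B C where G: "graph G" and V: "verts G = A \<union> B \<union> C"
    and disjoint: "A \<inter> B = {}" "A \<inter> C = {}" "B \<inter> C = {}"
    and cards: "card A = a" "card B = b" "card C = c"
    and ends: "arcs_ends G = A \<times> B \<union> B \<times> A \<union> A \<times> C \<union> C \<times> A \<union> B \<times> C \<union> C \<times> B"
    using assms(4) unfolding complete_tripartite_digraph_def by blast
  have finite: "finite A" "finite B" "finite C"
    using assms(1-3) cards by (auto intro: card_ge_0_finite)
  have nonempty: "A \<noteq> {}" "B \<noteq> {}" "C \<noteq> {}" using assms(1-3) cards by auto
  have nbs: "v \<in> A \<Longrightarrow> neighbors G v = B \<union> C" "v \<in> B \<Longrightarrow> neighbors G v = A \<union> C"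
    "v \<in> C \<Longrightarrow> neighbors G v = A \<union> B" for v
    unfolding neighbors_def ends using disjoint by auto
  have nbs_V: "neighbors G v \<subseteq> verts G" for v unfolding neighbors_def ends V by auto
  define k where "k = real b + real c - real a"
  define D where "D = real b * real c / k"
  have k: "0 < k" using assms(1-3) unfolding k_def by linarith
  have Dk: "D * k = real b * real c" unfolding D_def using k by simp
  have fin_V: "finite (verts G)" and ne: "verts G \<noteq> {}" using V finite nonempty by auto
  note attained = min_defect_attained[OF G ne, of 2, simplified]
  have "D \<le> min_defect G 2"
  proof (rule ccontr)
    assume less: "\<not> D \<le> min_defect G 2"
    obtain f where f: "fractional_coloring G 2 f" "defect G 2 f = min_defect G 2"
      using attained(1) by blast
    have small: "closeness (\<lambda>v. f v 1) (neighbors G v) v < D" if "v \<in> A \<union> B \<union> C" for v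
    proof -
      have "vertex_defect G 2 f v \<le> defect G 2 f"
        unfolding defect_def using fin_V that V by (intro Max_ge) auto
      then show ?thesis
        using vertex_defect_2[OF f(1) _ nbs_V] that V f(2) less by auto
    qed
    show False
    proof (rule no_low_defect_points[of A B C "\<lambda>v. f v 1" D])
      show "D * (real (card B) + real (card C) - real (card A)) = real (card B) * real (card C)"
        using Dk unfolding cards k_def .
      show "closeness (\<lambda>v. f v 1) (B \<union> C) v < D" if "v \<in> A" for v using small[of v] nbs that by auto
      show "closeness (\<lambda>v. f v 1) (A \<union> C) v < D" if "v \<in> B" for v using small[of v] nbs that by auto
      show "closeness (\<lambda>v. f v 1) (A \<union> B) v < D" if "v \<in> C" for v using small[of v] nbs that by auto
      show "f v 1 \<in> {0..1}" if "v \<in> A \<union> B \<union> C" for v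
        using fractional_coloring_2_range[OF f(1)] that V by auto
    qed (use finite disjoint cards assms(1-3) in auto)
  qed
  moreover have "min_defect G 2 \<le> D"
  proof -
    \<comment> \<open>\<open>t\<close> solves \<open>b (1 - t) = a (1 - t) + c t\<close>, which equalises the defects of \<open>A\<close> and \<open>B\<close>.\<close>
    define t where "t = (real b - real a) / k"
    define x where "x v = (if v \<in> A then 0 else if v \<in> C then 1 else t)" for v
    define g where "g v j = (if j = 1 then x v else 1 - x v)" for v and j :: nat
    have two: "{1..2} = {1, 2::nat}" by auto
    have t: "0 \<le> t" "t \<le> 1 / 2" using k assms(1-3) unfolding t_def k_def by (auto simp: field_simps)
    have x: "v \<in> A \<Longrightarrow> x v = 0" "v \<in> B \<Longrightarrow> x v = t" "v \<in> C \<Longrightarrow> x v = 1" for v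
      unfolding x_def using disjoint by auto
    have g: "fractional_coloring G 2 g"
      using t unfolding fractional_coloring_def two by (auto simp: g_def x_def)
    have bt: "real b * (1 - t) = D" "real a * (1 - t) + real c * t = D"
      using k unfolding t_def D_def by (simp_all add: field_simps) (simp_all add: k_def algebra_simps)
    have "real b * t \<le> real b * (1 - t)" using t by (intro mult_left_mono) auto
    with bt(1) have C: "real b * t \<le> D" by simp
    have "vertex_defect G 2 g v \<le> D" if v: "v \<in> verts G" for v
    proof -
      have Un: "closeness x (X \<union> Y) v = closeness x X v + closeness x Y v"
        if "finite X" "finite Y" "X \<inter> Y = {}" for X Y
        unfolding closeness_def using that by (rule sum.union_disjoint)
      have parts: "closeness x A v = a * (1 - \<bar>x v\<bar>)" "closeness x B v = b * (1 - \<bar>x v - t\<bar>)"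
        "closeness x C v = c * (1 - \<bar>x v - 1\<bar>)"
        unfolding closeness_def by (simp_all add: x cards cong: sum.cong)
      have "(\<lambda>v. g v 1) = x" by (simp add: g_def)
      then have "vertex_defect G 2 g v = closeness x (neighbors G v) v"
        using vertex_defect_2[OF g v nbs_V] by simp
      also have "\<dots> \<le> D"
      proof -
        consider "v \<in> A" | "v \<in> B" | "v \<in> C" using v V by auto
        then show ?thesis
        proof cases
          case 1
          then have "closeness x (neighbors G v) v = b * (1 - t)"
            using t finite disjoint by (simp add: nbs(1) Un parts x(1))
          with bt(1) show ?thesis by simp
        next
          case 2
          then have "closeness x (neighbors G v) v = a * (1 - t) + c * t"
            using t finite disjoint by (simp add: nbs(2) Un parts x(2))
          with bt(2) show ?thesis by simp
        next
          case 3
          then have "closeness x (neighbors G v) v = b * t"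
            using t finite disjoint by (simp add: nbs(3) Un parts x(3))
          with C show ?thesis by simp
        qed
      qed
      finally show ?thesis .
    qed
    then have "defect G 2 g \<le> D"
      unfolding defect_def using fin_V ne by (intro Max.boundedI) auto
    with attained(2)[OF g] show ?thesis by linarith
  qed
  ultimately have "min_defect G 2 = D" by (rule order_antisym[rotated])
  then show ?thesis by (simp only: D_def k_def)
qed

end
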